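(* Let $A, B \in M_n(\mathbb{C})$ be such that the pair $(A,B)$ has property L. Assume that $B$ is diagonalizable and that $A + z_0 B$ is diagonalizable for every exceptional point $z_0$ of the matrix pencil $z \mapsto A + zB$. Then $AB = BA$.
   Context: A pair $(A,B) \in M_n(\mathbb{C})^2$ has property L if there exist $n$ linear forms $f_1,\dots,f_n$ on $\mathbb{C}^2$ such that for all $(x,y) \in \mathbb{C}^2$, the characteristic polynomial of $xA+yB$ equals $\prod_{k=1}^n (X - f_k(x,y))$. The generic number $p$ of eigenvalues of the pencil $z \mapsto A+zB$ is the number of distinct eigenvalues of the matrix $A + tB$, viewed over the field of fractions of the ring of entire functions in the variable $t$ (with $t$ the identity function), in an algebraic closure of that field. A complex number $z$ is regular if $A+zB$ has exactly $p$ distinct eigenvalues, and exceptional otherwise. *)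

theory Defs
  imports "Jordan_Normal_Form.Char_Poly"
          "HOL-Algebra.Algebraic_Closure_Type"
          "HOL-Computational_Algebra.Fraction_Field"
begin

definition property_L :: "nat \<Rightarrow> complex mat \<Rightarrow> complex mat \<Rightarrow> bool" where
  "property_L n A B \<longleftrightarrow>
     (\<exists>a b :: nat \<Rightarrow> complex. \<forall>x y :: complex.
        char_poly (x \<cdot>\<^sub>m A + y \<cdot>\<^sub>m B) = (\<Prod>k<n. [:- (a k * x + b k * y), 1:]))"

text \<open>The matrix A + tB with t an indeterminate, with entries in the field of fractions
  of C[t] (a subfield of the field of fractions of the ring of entire functions).\<close>
definition generic_pencil :: "complex mat \<Rightarrow> complex mat \<Rightarrow> complex poly fract mat" where
  "generic_pencil A B =
     map_mat (\<lambda>a. to_fract [:a:]) A + map_mat (\<lambda>b. to_fract [:0, b:]) B"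

definition generic_num_eigenvalues :: "complex mat \<Rightarrow> complex mat \<Rightarrow> nat" where
  "generic_num_eigenvalues A B =
     card {r :: complex poly fract alg_closure.
             poly (map_poly to_ac (char_poly (generic_pencil A B))) r = 0}"

definition num_eigenvalues :: "complex mat \<Rightarrow> nat" where
  "num_eigenvalues M = card {r. poly (char_poly M) r = 0}"

definition regular_point :: "complex mat \<Rightarrow> complex mat \<Rightarrow> complex \<Rightarrow> bool" where
  "regular_point A B z \<longleftrightarrow> num_eigenvalues (A + z \<cdot>\<^sub>m B) = generic_num_eigenvalues A B"

definition exceptional_point :: "complex mat \<Rightarrow> complex mat \<Rightarrow> complex \<Rightarrow> bool" where
  "exceptional_point A B z \<longleftrightarrow> \<not> regular_point A B z"

definition diagonalizable :: "complex mat \<Rightarrow> bool" where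
  "diagonalizable M \<longleftrightarrow> (\<exists>D. similar_mat M D \<and> diagonal_mat D)"

end

theory Submission
  imports Defs
begin

text \<open>
  Write the eigenvalues of A + zB as lines f_k(z) = a_k + b_k z with multiplicities m_k and consider
  the adjugate G of X - A - zB, whose entries have total degree at most n - 1. Where A + zB is
  diagonalizable and lines of total multiplicity m meet in a point p, the matrix X - A - zB has rank
  n - m at p, so the entries of G vanish to order m - 1 there; diagonalizability of B gives the same
  at the point at infinity of every line. Counting zeros, the Taylor coefficients of G transversal
  to the line X = f_k(z) vanish in degrees below m_k - 1, and the one in degree m_k - 1 is a constant
  matrix C_k times a fixed polynomial (unless B is scalar). Since (X - A - zB) G is the
  characteristic polynomial times the identity, A C_k = a_k C_k and B C_k = b_k C_k, so
  W = AB - BA annihilates C_k. Hence every (X - f_k)^(m_k) divides W G, whose degree in X is less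
  than n; so W G = 0 and W = 0.
\<close>

subsection \<open>Graded families and adjugates\<close>

text \<open>A multiplicative filtration. No monotonicity in \<open>d\<close> is asked for, so that
  decreasing filtrations (order of vanishing) and increasing ones (degree bounds) are both
  instances.\<close>

locale graded_family =
  fixes F :: "nat \<Rightarrow> 'a::comm_ring_1 set"
  assumes zero_mem: "0 \<in> F d"
    and one_mem: "1 \<in> F 0"
    and add_mem: "p \<in> F d \<Longrightarrow> q \<in> F d \<Longrightarrow> p + q \<in> F d"
    and uminus_mem: "p \<in> F d \<Longrightarrow> - p \<in> F d"
    and mult_mem: "p \<in> F d \<Longrightarrow> q \<in> F e \<Longrightarrow> p * q \<in> F (d + e)"
begin

lemma sum_mem: "(\<And>i. i \<in> I \<Longrightarrow> p i \<in> F d) \<Longrightarrow> sum p I \<in> F d"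
  by (induction I rule: infinite_finite_induct) (auto intro: zero_mem add_mem)

lemma prod_mem:
  "finite I \<Longrightarrow> (\<And>i. i \<in> I \<Longrightarrow> p i \<in> F (e i)) \<Longrightarrow> prod p I \<in> F (sum e I)"
  by (induction I rule: finite_induct) (auto intro: one_mem mult_mem)

lemma signof_mult_mem: "p \<in> F d \<Longrightarrow> signof \<pi> * p \<in> F d"
  by (cases "sign \<pi> = 1") (auto simp: sign_def intro: uminus_mem)

text \<open>Each term of the Leibniz expansion takes exactly one entry from every row, so the row
  weights \<open>e i\<close> add up.\<close>

lemma det_mem:
  assumes M: "M \<in> carrier_mat n n"
    and rows: "\<And>i j. i < n \<Longrightarrow> j < n \<Longrightarrow> M $$ (i, j) \<in> F (e i)"
  shows "det M \<in> F (\<Sum>i<n. e i)"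
  unfolding det_def'[OF M]
proof (rule sum_mem, rule signof_mult_mem)
  fix \<pi> assume "\<pi> \<in> {\<pi>. \<pi> permutes {0..<n}}"
  then have "\<pi> i < n" if "i < n" for i
    using that permutes_in_image[of \<pi> "{0..<n}" i] by auto
  then show "(\<Prod>i = 0..<n. M $$ (i, \<pi> i)) \<in> F (\<Sum>i<n. e i)"
    using prod_mem[of "{0..<n}" "\<lambda>i. M $$ (i, \<pi> i)" e] rows
    by (simp add: atLeast0LessThan)
qed

text \<open>The entry \<open>(r, c)\<close> is up to sign the minor with row \<open>c\<close> and
  column \<open>r\<close> deleted, so every row except \<open>c\<close> contributes its weight;
  \<open>insert_index c\<close> enumerates the remaining rows.\<close>

lemma adj_mat_mem:
  assumes M: "M \<in> carrier_mat n n"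
    and rows: "\<And>i j. i < n \<Longrightarrow> j < n \<Longrightarrow> M $$ (i, j) \<in> F (e i)"
    and r: "r < n" and c: "c < n"
  shows "adj_mat M $$ (r, c) \<in> F (\<Sum>i\<in>{..<n} - {c}. e i)"
proof -
  obtain k where n: "n = Suc k" using r by (cases n) auto
  have "det (mat_delete M c r) \<in> F (\<Sum>i<k. e (insert_index c i))"
  proof (rule det_mem)
    show "mat_delete M c r \<in> carrier_mat k k"
      using mat_delete_carrier[OF M] n by simp
    fix i j assume ij: "i < k" "j < k"
    have "mat_delete M c r $$ (i, j) = M $$ (insert_index c i, insert_index r j)"
      using mat_delete_index[of M k c r i j] M r c ij n by simp
    moreover have "insert_index c i < n" "insert_index r j < n"
      using ij n by (auto simp: insert_index_def)
    ultimately show "mat_delete M c r $$ (i, j) \<in> F (e (insert_index c i))"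
      using rows by simp
  qed
  also have "(\<Sum>i<k. e (insert_index c i)) = (\<Sum>i\<in>insert_index c ` {..<k}. e i)"
    by (simp add: sum.reindex insert_index_inj_on)
  also have "insert_index c ` {..<k} = {..<n} - {c}"
    using insert_index_image[of c k] c n by (simp add: atLeast0LessThan)
  finally have *: "det (mat_delete M c r) \<in> F (\<Sum>i\<in>{..<n} - {c}. e i)" .
  have "cofactor M c r \<in> F (\<Sum>i\<in>{..<n} - {c}. e i)"
    unfolding cofactor_def by (cases "even (c + r)") (auto intro: * uminus_mem)
  then show ?thesis
    using M r c by (simp add: adj_mat_def)
qed

lemma mat_mult_mem:
  assumes "M \<in> carrier_mat n n" "M' \<in> carrier_mat n n"
    and "\<And>i j. i < n \<Longrightarrow> j < n \<Longrightarrow> M $$ (i, j) \<in> F d"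
    and "\<And>i j. i < n \<Longrightarrow> j < n \<Longrightarrow> M' $$ (i, j) \<in> F e"
    and "i < n" "j < n"
  shows "(M * M') $$ (i, j) \<in> F (d + e)"
  using assms by (auto simp: scalar_prod_def intro!: sum_mem mult_mem)

end

section \<open>Adjugates under conjugation and ring homomorphisms\<close>

lemma adj_mat_unique:
  fixes M :: "'a::idom mat"
  assumes M: "M \<in> carrier_mat n n" and Y: "Y \<in> carrier_mat n n"
    and MY: "M * Y = det M \<cdot>\<^sub>m 1\<^sub>m n" and det: "det M \<noteq> 0"
  shows "Y = adj_mat M"
proof -
  note adj = adj_mat[OF M]
  have "det M \<cdot>\<^sub>m Y = (adj_mat M * M) * Y"
    using Y by (simp add: adj(3) mult_smult_assoc_mat[of _ n n])
  also have "\<dots> = adj_mat M * (M * Y)"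
    using adj(1) M Y by (simp add: assoc_mult_mat[of _ n n _ n _ n])
  also have "\<dots> = det M \<cdot>\<^sub>m adj_mat M"
    using adj(1) by (simp add: MY mult_smult_distrib[of _ n n _ n])
  finally have eq: "det M \<cdot>\<^sub>m Y = det M \<cdot>\<^sub>m adj_mat M" .
  show ?thesis
  proof (rule eq_matI)
    fix i j assume "i < dim_row (adj_mat M)" "j < dim_col (adj_mat M)"
    then show "Y $$ (i, j) = adj_mat M $$ (i, j)"
      using arg_cong[OF eq, of "\<lambda>Q. Q $$ (i, j)"] Y adj(1) det by auto
  qed (use Y adj(1) in auto)
qed

text \<open>The conjugated adjugate satisfies the equation that characterizes the adjugate by
  \<open>adj_mat_unique\<close>, since conjugation preserves the determinant and scalar
  matrices.\<close>

lemma adj_mat_conjugate: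
  fixes M :: "'a::idom mat"
  assumes M: "M \<in> carrier_mat n n" and S: "S \<in> carrier_mat n n" and T: "T \<in> carrier_mat n n"
    and ST: "S * T = 1\<^sub>m n" and TS: "T * S = 1\<^sub>m n"
    and det: "det (S * M * T) \<noteq> 0"
  shows "adj_mat (S * M * T) = S * adj_mat M * T"
proof (rule adj_mat_unique[symmetric])
  note adj = adj_mat[OF M]
  note [simp] = assoc_mult_mat[of _ n n _ n _ n]
  show "S * M * T \<in> carrier_mat n n" "S * adj_mat M * T \<in> carrier_mat n n"
    using M S T adj(1) by auto
  have "det S * det T = 1"
    using det_mult[OF S T] ST by simp
  then have dets: "det (S * M * T) = det M"
    using M S T by (simp add: det_mult[of _ n] ac_simps)
  have "S * M * T * (S * adj_mat M * T) = S * M * (T * S) * (adj_mat M * T)"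
    using M S T adj(1) by simp
  also have "\<dots> = S * (M * adj_mat M) * T"
    using M S T adj(1) TS by simp
  also have "\<dots> = det M \<cdot>\<^sub>m 1\<^sub>m n"
    using S T ST by (simp add: adj(2) mult_smult_distrib[of _ n n _ n] mult_smult_assoc_mat[of _ n n _ n])
  finally show "S * M * T * (S * adj_mat M * T) = det (S * M * T) \<cdot>\<^sub>m 1\<^sub>m n"
    by (simp add: dets)
qed (use det in auto)

lemma (in comm_ring_hom) adj_mat_hom:
  assumes "M \<in> carrier_mat n n"
  shows "adj_mat (map_mat hom M) = map_mat hom (adj_mat M)"
proof (rule eq_matI)
  fix i j assume "i < dim_row (map_mat hom (adj_mat M))" "j < dim_col (map_mat hom (adj_mat M))"
  then have ij: "i < n" "j < n" using assms by (auto simp: adj_mat_def)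
  have "mat_delete (map_mat hom M) j i = map_mat hom (mat_delete M j i)"
    using assms ij by (auto simp: mat_delete_def)
  then show "adj_mat (map_mat hom M) $$ (i, j) = map_mat hom (adj_mat M) $$ (i, j)"
    using assms ij by (simp add: adj_mat_def cofactor_def hom_mult hom_power hom_uminus)
qed (use assms in \<open>auto simp: adj_mat_def\<close>)

text \<open>Multiplication by matrices of weight 0 does not change weights, so the adjugate can be
  estimated in a basis where the rows of \<open>M\<close> are simple. The hypothesis
  \<open>sub\<close> absorbs the choice of the deleted row, in whichever direction the filtration
  runs.\<close>

lemma (in graded_family) adj_mat_conjugate_mem:
  fixes M :: "'a mat"
  assumes M: "M \<in> carrier_mat n n" and S: "S \<in> carrier_mat n n" and T: "T \<in> carrier_mat n n"
    and adj: "adj_mat (S * M * T) = S * adj_mat M * T"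
    and S0: "\<And>i j. i < n \<Longrightarrow> j < n \<Longrightarrow> S $$ (i, j) \<in> F 0"
    and T0: "\<And>i j. i < n \<Longrightarrow> j < n \<Longrightarrow> T $$ (i, j) \<in> F 0"
    and rows: "\<And>i j. i < n \<Longrightarrow> j < n \<Longrightarrow> M $$ (i, j) \<in> F (e i)"
    and sub: "\<And>c. c < n \<Longrightarrow> F (\<Sum>i\<in>{..<n} - {c}. e i) \<subseteq> F d"
    and "i < n" "j < n"
  shows "adj_mat (S * M * T) $$ (i, j) \<in> F d"
proof -
  have adjM: "adj_mat M $$ (r, c) \<in> F d" if "r < n" "c < n" for r c
    using adj_mat_mem[OF M rows that] sub[OF that(2)] by blast
  have "(S * adj_mat M) $$ (r, c) \<in> F d" if "r < n" "c < n" for r c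
    using mat_mult_mem[OF S adj_mat(1)[OF M] S0 adjM that] by simp
  then have "(S * adj_mat M * T) $$ (i, j) \<in> F (d + 0)"
    using S T adj_mat(1)[OF M] assms(9,10) by (intro mat_mult_mem[OF _ T _ T0]) auto
  then show ?thesis using adj by simp
qed

lemma prod_linear_power_dvd:
  fixes q :: "'a::field_gcd poly"
  assumes "finite Z" and "\<And>z. z \<in> Z \<Longrightarrow> [:-z, 1:] ^ e z dvd q"
  shows "(\<Prod>z\<in>Z. [:-z, 1:] ^ e z) dvd q"
  using assms
proof (induction Z rule: finite_induct)
  case (insert x Z)
  have "coprime [:-x, 1:] [:-z, 1:]" if "z \<in> Z" for z
  proof (rule coprimeI)
    fix c assume "c dvd [:-x, 1:]" "c dvd [:-z, 1:]"
    then have "c dvd [:-x, 1:] - [:-z, 1:]" by (rule dvd_diff)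
    then have "c dvd [:z - x:]" by simp
    moreover have "z \<noteq> x" using insert that by auto
    ultimately show "is_unit c" 
      by (meson dvd_trans is_unit_const_poly_iff dvd_field_iff right_minus_eq)
  qed
  then have "coprime ([:-x, 1:] ^ e x) (\<Prod>z\<in>Z. [:-z, 1:] ^ e z)"
    by (intro prod_coprime_right) auto
  then show ?case using insert by (auto intro: divides_mult)
qed auto

subsection \<open>The pencil over polynomial rings\<close>

definition poly_pencil :: "complex mat \<Rightarrow> complex mat \<Rightarrow> complex poly mat" where
  "poly_pencil A B = map_mat (\<lambda>a. [:a:]) A + map_mat (\<lambda>b. [:0, b:]) B"

definition const_mat :: "complex mat \<Rightarrow> complex poly poly mat" where
  "const_mat = map_mat (\<lambda>a. [:[:a:]:])"

text \<open>The matrix X + f - A - zB over C[z][X]: the variable X of the outer polynomial ring measures the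
  distance from the line f.\<close>

definition shifted_pencil ::
    "complex poly \<Rightarrow> complex mat \<Rightarrow> complex mat \<Rightarrow> complex poly poly mat" where
  "shifted_pencil f A B = [:f, 1:] \<cdot>\<^sub>m 1\<^sub>m (dim_row A) - const_mat A - [:[:0, 1:]:] \<cdot>\<^sub>m const_mat B"

interpretation const_hom: comm_ring_hom "\<lambda>a::complex. [:[:a:]:]"
  by unfold_locales (auto simp: one_pCons)

lemma const_mat_carrier [simp]: "const_mat A \<in> carrier_mat n m \<longleftrightarrow> A \<in> carrier_mat n m"
  by (auto simp: const_mat_def)

lemma const_mat_mult:
  "A \<in> carrier_mat n n \<Longrightarrow> B \<in> carrier_mat n n \<Longrightarrow> const_mat (A * B) = const_mat A * const_mat B"
  unfolding const_mat_def by (rule const_hom.mat_hom_mult)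

lemma const_mat_one: "const_mat (1\<^sub>m n) = 1\<^sub>m n"
  unfolding const_mat_def by (rule const_hom.mat_hom_one)

lemma const_mat_index:
  "A \<in> carrier_mat n n \<Longrightarrow> i < n \<Longrightarrow> j < n \<Longrightarrow> const_mat A $$ (i, j) = [:[:A $$ (i, j):]:]"
  by (simp add: const_mat_def)

lemma shifted_pencil_carrier [simp]:
  "A \<in> carrier_mat n n \<Longrightarrow> B \<in> carrier_mat n n \<Longrightarrow> shifted_pencil f A B \<in> carrier_mat n n"
  by (simp add: shifted_pencil_def minus_carrier_mat)

lemma shifted_pencil_index:
  assumes "A \<in> carrier_mat n n" "B \<in> carrier_mat n n" "i < n" "j < n"
  shows "shifted_pencil f A B $$ (i, j) =
    [:(if i = j then f else 0) - [:A $$ (i, j), B $$ (i, j):], if i = j then 1 else 0:]"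
  using assms by (auto simp: shifted_pencil_def const_mat_def)

lemma shifted_pencil_conjugate:
  assumes A: "A \<in> carrier_mat n n" and B: "B \<in> carrier_mat n n"
    and S: "S \<in> carrier_mat n n" and T: "T \<in> carrier_mat n n" and ST: "S * T = 1\<^sub>m n"
  shows "shifted_pencil f (S * A * T) (S * B * T) =
    const_mat S * shifted_pencil f A B * const_mat T"
proof -
  let ?S = "const_mat S" and ?T = "const_mat T" and ?A = "const_mat A" and ?B = "const_mat B"
  note c = A B S T
  have ST': "?S * ?T = 1\<^sub>m n"
    using const_mat_mult[OF S T] by (simp add: ST const_mat_one)
  have "?S * shifted_pencil f A B * ?T =
    ?S * ([:f, 1:] \<cdot>\<^sub>m 1\<^sub>m n) * ?T - ?S * ?A * ?T - ?S * ([:[:0, 1:]:] \<cdot>\<^sub>m ?B) * ?T"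
    using c by (simp add: shifted_pencil_def minus_carrier_mat mult_minus_distrib_mat[of _ n n _ n]
        minus_mult_distrib_mat[of _ n n _ _ n])
  also have "?S * ([:f, 1:] \<cdot>\<^sub>m 1\<^sub>m n) * ?T = [:f, 1:] \<cdot>\<^sub>m 1\<^sub>m n"
    using c ST' by (simp add: mult_smult_distrib[of _ n n _ n] mult_smult_assoc_mat[of _ n n _ n])
  also have "?S * ([:[:0, 1:]:] \<cdot>\<^sub>m ?B) * ?T = [:[:0, 1:]:] \<cdot>\<^sub>m (?S * ?B * ?T)"
    using c by (simp add: mult_smult_distrib[of _ n n _ n] mult_smult_assoc_mat[of _ n n _ n])
  finally show ?thesis
    using c by (simp add: shifted_pencil_def const_mat_mult[of _ n])
qed

text \<open>Moving the line \<open>f\<close> to X = 0 is the substitution X -> X + f, a ring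
  homomorphism; determinant and adjugate are therefore carried along with it.\<close>

lemma shifted_pencil_char_poly_matrix:
  assumes "A \<in> carrier_mat n n" "B \<in> carrier_mat n n"
  shows "shifted_pencil f A B =
    map_mat (\<lambda>q. q \<circ>\<^sub>p [:f, 1:]) (char_poly_matrix (poly_pencil A B))"
proof (rule eq_matI)
  fix i j assume "i < dim_row (map_mat (\<lambda>q. q \<circ>\<^sub>p [:f, 1:]) (char_poly_matrix (poly_pencil A B)))"
    "j < dim_col (map_mat (\<lambda>q. q \<circ>\<^sub>p [:f, 1:]) (char_poly_matrix (poly_pencil A B)))"
  then show "shifted_pencil f A B $$ (i, j) =
      map_mat (\<lambda>q. q \<circ>\<^sub>p [:f, 1:]) (char_poly_matrix (poly_pencil A B)) $$ (i, j)"
    using assms 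
    by (auto simp: shifted_pencil_index[of _ n] char_poly_matrix_def poly_pencil_def pcompose_pCons)
qed (use assms in \<open>auto simp: char_poly_matrix_def poly_pencil_def shifted_pencil_def const_mat_def\<close>)

lemma det_shifted_pencil:
  assumes "A \<in> carrier_mat n n" "B \<in> carrier_mat n n"
  shows "det (shifted_pencil f A B) = char_poly (poly_pencil A B) \<circ>\<^sub>p [:f, 1:]"
  unfolding shifted_pencil_char_poly_matrix[OF assms] char_poly_def
  by (rule comm_ring_hom.hom_det[OF pcompose_hom.comm_ring_hom_axioms])

text \<open>Recovers the multiplicities from a product of linear factors, so that two factorizations
  of one polynomial can be compared root by root.\<close>

lemma order_prod_linear:
  fixes c :: "nat \<Rightarrow> 'a::idom"
  shows "Polynomial.order x (\<Prod>k<n. [:- c k, 1:]) = card {k. k < n \<and> c k = x}"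
proof (induction n)
  case (Suc n)
  have "(\<Prod>k<Suc n. [:- c k, 1:]) \<noteq> 0" by (subst prod_zero_iff) auto
  then have "Polynomial.order x (\<Prod>k<Suc n. [:- c k, 1:]) =
      card {k. k < n \<and> c k = x} + Polynomial.order x [:- c n, 1:]"
    using Suc by (simp add: order_mult del: mult_pCons_left mult_pCons_right)
  also have "Polynomial.order x [:- c n, 1:] = (if c n = x then 1 else 0)"
    using order_power_n_n[of x 1] by (auto intro!: order_0I)
  also have "card {k. k < n \<and> c k = x} + (if c n = x then 1 else 0) = card {k. k < Suc n \<and> c k = x}"
  proof (cases "c n = x")
    case True
    then have "{k. k < Suc n \<and> c k = x} = insert n {k. k < n \<and> c k = x}" by (auto simp: less_Suc_eq)
    with True show ?thesis by simp
  next
    case False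
    then have "{k. k < Suc n \<and> c k = x} = {k. k < n \<and> c k = x}" by (auto simp: less_Suc_eq)
    with False show ?thesis by simp
  qed
  finally show ?case .
qed simp

text \<open>The characteristic polynomial factors both over the diagonal of \<open>D\<close> and
  over \<open>c\<close>; equal root orders show that both lists take each value equally often. Only
  these counts are used later, not a matching of the indices.\<close>

lemma diagonalizableE:
  assumes diag: "diagonalizable M" and M: "M \<in> carrier_mat n n"
    and cp: "char_poly M = (\<Prod>k<n. [:- c k, 1:])"
  obtains S T D where "S \<in> carrier_mat n n" "T \<in> carrier_mat n n" "D \<in> carrier_mat n n"
    "S * T = 1\<^sub>m n" "T * S = 1\<^sub>m n" "D = T * M * S" "diagonal_mat D"
    "\<forall>x. card {i. i < n \<and> D $$ (i, i) = x} = card {k. k < n \<and> c k = x}"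
proof -
  obtain D S T where D: "diagonal_mat D" and wit: "similar_mat_wit M D S T"
    using diag by (auto simp: diagonalizable_def similar_mat_def)
  note w = similar_mat_witD2[OF M wit]
  have w': "D = T * M * S"
    using similar_mat_witD2(3)[OF w(5) similar_mat_wit_sym[OF wit]] .
  have "char_poly D = char_poly M"
    using char_poly_similar wit by (metis similar_mat_def)
  moreover have "char_poly D = (\<Prod>i<n. [:- D $$ (i, i), 1:])"
    using char_poly_upper_triangular[OF w(5)] D w(5)
    by (auto simp: upper_triangular_def diagonal_mat_def diag_mat_def prod.list_conv_set_nth
        atLeast0LessThan)
  ultimately have "(\<Prod>i<n. [:- D $$ (i, i), 1:]) = (\<Prod>k<n. [:- c k, 1:])"
    using cp by simp
  then have "\<forall>x. card {i. i < n \<and> D $$ (i, i) = x} = card {k. k < n \<and> c k = x}"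
    unfolding order_prod_linear[symmetric] by simp
  then show thesis by (rule that[OF w(6,7,5,1,2) w' D])
qed

text \<open>Polynomials in X over a ring containing t that lie in the ideal power (X, t)^d.\<close>

definition vanishing_order :: "'a::comm_ring_1 \<Rightarrow> nat \<Rightarrow> 'a poly set" where
  "vanishing_order t d = {q. \<forall>i. t ^ (d - i) dvd Polynomial.coeff q i}"

text \<open>Bounds the degree in z of every coefficient and ignores the degree in X. It controls the
  behaviour at the point at infinity of a line, as \<open>vanishing_order\<close> does at a finite
  point.\<close>

definition coeff_degree_le :: "nat \<Rightarrow> 'a::comm_ring_1 poly poly set" where
  "coeff_degree_le d = {q. \<forall>i. Polynomial.degree (Polynomial.coeff q i) \<le> d}"

section \<open>Filtrations by vanishing order and by degree in z\<close>

lemma vanishing_order_antimono: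
  assumes "d \<le> e"
  shows "vanishing_order t e \<subseteq> vanishing_order t d"
proof
  fix q assume "q \<in> vanishing_order t e"
  then have "t ^ (d - i) dvd Polynomial.coeff q i" for i
    using le_imp_power_dvd[OF diff_le_mono[OF assms], of t i]
    by (auto simp: vanishing_order_def intro: dvd_trans)
  then show "q \<in> vanishing_order t d" by (simp add: vanishing_order_def)
qed

lemma graded_family_vanishing_order: "graded_family (vanishing_order t)"
proof
  fix p q d e assume p: "p \<in> vanishing_order t d" and q: "q \<in> vanishing_order t e"
  have "t ^ (d + e - k) dvd Polynomial.coeff p i * Polynomial.coeff q (k - i)" if "i \<le> k" for i k
  proof -
    \<comment> \<open>Truncated subtraction works in favour of the claim: rounding up to 0 only
      enlarges the exponent on the right.\<close>
    have "t ^ (d + e - k) dvd t ^ (d - i) * t ^ (e - (k - i))"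
      unfolding power_add[symmetric] using that by (intro le_imp_power_dvd) auto
    also have "\<dots> dvd Polynomial.coeff p i * Polynomial.coeff q (k - i)"
      using p q by (intro mult_dvd_mono) (auto simp: vanishing_order_def)
    finally show ?thesis .
  qed
  then show "p * q \<in> vanishing_order t (d + e)"
    by (auto simp: vanishing_order_def coeff_mult intro!: dvd_sum)
qed (auto simp: vanishing_order_def)

lemma graded_family_coeff_degree_le: "graded_family coeff_degree_le"
proof
  fix p q :: "'a poly poly" and d e assume p: "p \<in> coeff_degree_le d" and q: "q \<in> coeff_degree_le e"
  then show "p * q \<in> coeff_degree_le (d + e)"
    by (auto simp: coeff_degree_le_def coeff_mult
        intro!: degree_sum_le order.trans[OF degree_mult_le] add_mono)
qed (auto simp: coeff_degree_le_def coeff_1 intro: degree_add_le)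

section \<open>Bounds on the adjugate at a finite point and at infinity\<close>

lemma conjugate_inverse:
  fixes A :: "'a::comm_ring_1 mat"
  assumes "A \<in> carrier_mat n n" "S \<in> carrier_mat n n" "T \<in> carrier_mat n n" "S * T = 1\<^sub>m n"
  shows "S * (T * A * S) * T = A"
proof -
  have "S * (T * A * S) * T = (S * T) * A * (S * T)"
    using assms(1-3) by (simp add: assoc_mult_mat[of _ n n _ n _ n])
  then show ?thesis using assms by simp
qed

text \<open>Reduces a bound on the adjugate to row weights of the pencil in another basis; the base
  change is by constant matrices, which have weight 0.\<close>

lemma adj_shifted_pencil_conjugate_mem:
  fixes F :: "nat \<Rightarrow> complex poly poly set"
  assumes F: "graded_family F" and const: "\<And>c. [:[:c:]:] \<in> F 0"
    and A: "A \<in> carrier_mat n n" and B: "B \<in> carrier_mat n n"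
    and S: "S \<in> carrier_mat n n" and T: "T \<in> carrier_mat n n"
    and ST: "S * T = 1\<^sub>m n" and TS: "T * S = 1\<^sub>m n"
    and det: "det (shifted_pencil f A B) \<noteq> 0"
    and rows: "\<And>i j. i < n \<Longrightarrow> j < n \<Longrightarrow>
      shifted_pencil f (T * A * S) (T * B * S) $$ (i, j) \<in> F (e i)"
    and sub: "\<And>c. c < n \<Longrightarrow> F (\<Sum>i\<in>{..<n} - {c}. e i) \<subseteq> F d"
    and ij: "i < n" "j < n"
  shows "adj_mat (shifted_pencil f A B) $$ (i, j) \<in> F d"
proof -
  let ?N = "shifted_pencil f (T * A * S) (T * B * S)"
  have N: "?N \<in> carrier_mat n n" using A B S T by simp
  have eq: "shifted_pencil f A B = const_mat S * ?N * const_mat T"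
    using shifted_pencil_conjugate[of "T * A * S" n "T * B * S" S T f]
    using A B S T unfolding conjugate_inverse[OF A S T ST] conjugate_inverse[OF B S T ST]
    by (simp add: ST mult_carrier_mat[of _ n n _ n])
  have STc: "const_mat S * const_mat T = 1\<^sub>m n" "const_mat T * const_mat S = 1\<^sub>m n"
    using const_mat_mult[OF S T] const_mat_mult[OF T S] by (simp_all add: ST TS const_mat_one)
  show ?thesis
    unfolding eq
  proof (rule graded_family.adj_mat_conjugate_mem[OF F N])
    show "adj_mat (const_mat S * ?N * const_mat T) = const_mat S * adj_mat ?N * const_mat T"
      using adj_mat_conjugate[OF N] STc S T det eq by simp
  qed (use S T ij rows sub in \<open>auto simp: const_mat_index[of _ n] const\<close>)
qed

lemma sum_indicator_card:
  fixes n :: nat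
  shows
  "(\<Sum>i<n. if P i then 1 else 0 :: nat) = card {i. i < n \<and> P i}"
proof -
  have "{i. i < n \<and> P i} = {..<n} \<inter> {i. P i}" by auto
  then show ?thesis by (simp add: sum.If_cases)
qed

text \<open>In an eigenbasis of \<open>A + z B\<close>, each row whose eigenvalue is
  \<open>poly f z\<close> vanishes at the point with parameter \<open>z\<close> on the line X = 0.
  Such rows get weight 1, and a cofactor loses at most one of them.\<close>

lemma adj_shifted_pencil_vanishing_order:
  assumes A: "A \<in> carrier_mat n n" and B: "B \<in> carrier_mat n n"
    and diag: "diagonalizable (A + z \<cdot>\<^sub>m B)"
    and cp: "char_poly (A + z \<cdot>\<^sub>m B) = (\<Prod>k<n. [:- c k, 1:])"
    and det: "det (shifted_pencil f A B) \<noteq> 0"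
    and ij: "i < n" "j < n"
  shows "adj_mat (shifted_pencil f A B) $$ (i, j)
    \<in> vanishing_order [:- z, 1:] (card {k. k < n \<and> c k = poly f z} - 1)"
proof -
  have "A + z \<cdot>\<^sub>m B \<in> carrier_mat n n" using A B by simp
  then obtain S T D where S: "S \<in> carrier_mat n n" and T: "T \<in> carrier_mat n n"
    and D: "D \<in> carrier_mat n n" and ST: "S * T = 1\<^sub>m n" "T * S = 1\<^sub>m n"
    and TMS: "D = T * (A + z \<cdot>\<^sub>m B) * S" and dD: "diagonal_mat D"
    and count: "\<forall>x. card {i. i < n \<and> D $$ (i, i) = x} = card {k. k < n \<and> c k = x}"
    by (rule diagonalizableE[OF diag _ cp])
  have A': "T * A * S \<in> carrier_mat n n" and B': "T * B * S \<in> carrier_mat n n"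
    using A B S T by auto
  have "D = T * A * S + z \<cdot>\<^sub>m (T * B * S)"
    using A B S T unfolding TMS
    by (simp add: mult_add_distrib_mat[of _ n n _ n] add_mult_distrib_mat[of _ n n _ _ n]
        mult_smult_distrib[of _ n n _ n] mult_smult_assoc_mat[of _ n n _ n])
  then have D_entry: "D $$ (i, j) = (T * A * S) $$ (i, j) + z * (T * B * S) $$ (i, j)"
    if "i < n" "j < n" for i j
    using that A B S T by auto
  define e where "e i = (if D $$ (i, i) = poly f z then 1 else 0 :: nat)" for i
  show ?thesis
  proof (rule adj_shifted_pencil_conjugate_mem[OF graded_family_vanishing_order _ A B S T ST det
        _ _ ij, where e = e])
    fix i j assume ij: "i < n" "j < n"
    \<comment> \<open>At \<open>z\<close> this polynomial takes the value
      \<open>poly f z - D $$ (i, i)\<close> on the diagonal and \<open>- D $$ (i, j)\<close> off it;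
      both are 0.\<close>
    have "[:- z, 1:] dvd (if i = j then f else 0) - [:(T * A * S) $$ (i, j), (T * B * S) $$ (i, j):]"
      if "D $$ (i, i) = poly f z"
      using that D_entry[OF ij] dD D ij unfolding poly_eq_0_iff_dvd[symmetric]
      by (auto simp: diagonal_mat_def)
    then show "shifted_pencil f (T * A * S) (T * B * S) $$ (i, j) \<in> vanishing_order [:- z, 1:] (e i)"
      unfolding shifted_pencil_index[OF A' B' ij]
      by (auto simp: vanishing_order_def e_def coeff_pCons split: nat.splits)
  next
    fix c' assume c': "c' < n"
    have "(\<Sum>i<n. e i) = e c' + (\<Sum>i\<in>{..<n} - {c'}. e i)"
      using c' by (simp add: sum.remove)
    moreover have "(\<Sum>i<n. e i) = card {k. k < n \<and> c k = poly f z}"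
      unfolding e_def sum_indicator_card using count by simp
    moreover have "e c' \<le> 1" by (simp add: e_def)
    ultimately have "card {k. k < n \<and> c k = poly f z} - 1 \<le> (\<Sum>i\<in>{..<n} - {c'}. e i)"
      by linarith
    then show "vanishing_order [:- z, 1:] (\<Sum>i\<in>{..<n} - {c'}. e i)
      \<subseteq> vanishing_order [:- z, 1:] (card {k. k < n \<and> c k = poly f z} - 1)"
      by (rule vanishing_order_antimono)
  qed (auto simp: vanishing_order_def)
qed

text \<open>In an eigenbasis of \<open>B\<close> the variable z occurs only on the diagonal, with
  coefficient \<open>\<beta> - D $$ (i, i)\<close>. Rows with eigenvalue \<open>\<beta>\<close> are
  thus free of z and the others have degree at most 1 in z.\<close>

lemma adj_shifted_pencil_coeff_degree_le:
  assumes A: "A \<in> carrier_mat n n" and B: "B \<in> carrier_mat n n"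
    and diag: "diagonalizable B"
    and cp: "char_poly B = (\<Prod>k<n. [:- b k, 1:])"
    and det: "det (shifted_pencil [:\<alpha>, \<beta>:] A B) \<noteq> 0"
    and ij: "i < n" "j < n"
  shows "adj_mat (shifted_pencil [:\<alpha>, \<beta>:] A B) $$ (i, j)
    \<in> coeff_degree_le (card {k. k < n \<and> b k \<noteq> \<beta>})"
proof -
  obtain S T D where S: "S \<in> carrier_mat n n" and T: "T \<in> carrier_mat n n"
    and D: "D \<in> carrier_mat n n" and ST: "S * T = 1\<^sub>m n" "T * S = 1\<^sub>m n"
    and TMS: "D = T * B * S" and dD: "diagonal_mat D"
    and count: "\<forall>x. card {i. i < n \<and> D $$ (i, i) = x} = card {k. k < n \<and> b k = x}"
    by (rule diagonalizableE[OF diag B cp])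
  have A': "T * A * S \<in> carrier_mat n n" and B': "T * B * S \<in> carrier_mat n n"
    using A B S T by auto
  define e where "e i = (if D $$ (i, i) \<noteq> \<beta> then 1 else 0 :: nat)" for i
  show ?thesis
  proof (rule adj_shifted_pencil_conjugate_mem[OF graded_family_coeff_degree_le _ A B S T ST det
        _ _ ij, where e = e])
    fix i j assume ij: "i < n" "j < n"
    then show "shifted_pencil [:\<alpha>, \<beta>:] (T * A * S) (T * B * S) $$ (i, j) \<in> coeff_degree_le (e i)"
      using dD D
      unfolding shifted_pencil_index[OF A' B' ij]
      unfolding TMS[symmetric]
      by (auto simp: coeff_degree_le_def e_def diagonal_mat_def coeff_pCons split: nat.splits)
  next
    fix c' assume c': "c' < n"
    \<comment> \<open>The fact \<open>count\<close> compares how often single values are taken, so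
      the other rows are counted by complement.\<close>
    have compl: "card {i. i < n \<and> d i \<noteq> \<beta>} = n - card {i. i < n \<and> d i = \<beta>}" for d :: "nat \<Rightarrow> complex"
    proof -
      have "{i. i < n \<and> d i \<noteq> \<beta>} = {..<n} - {i. i < n \<and> d i = \<beta>}" by auto
      then show ?thesis by (simp add: card_Diff_subset subset_eq)
    qed
    have "(\<Sum>i\<in>{..<n} - {c'}. e i) \<le> (\<Sum>i<n. e i)"
      by (intro sum_mono2) auto
    also have "\<dots> = card {k. k < n \<and> b k \<noteq> \<beta>}"
      unfolding e_def sum_indicator_card compl using count by simp
    finally show "coeff_degree_le (\<Sum>i\<in>{..<n} - {c'}. e i)
      \<subseteq> coeff_degree_le (card {k. k < n \<and> b k \<noteq> \<beta>})"
      by (auto simp: coeff_degree_le_def intro: order.trans)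
  qed (auto simp: coeff_degree_le_def coeff_pCons split: nat.splits)
qed

subsection \<open>The generic number of eigenvalues\<close>

lemma (in comm_ring_hom) map_poly_prod_linear:
  "map_poly hom (\<Prod>k<n. [:- c k, 1:]) = (\<Prod>k<n. [:- hom (c k), 1:])"
proof -
  interpret map_poly_hom: map_poly_comm_ring_hom ..
  show ?thesis by (simp add: map_poly_hom.hom_prod hom_uminus)
qed

lemma poly_prod_linear_eq_0_iff:
  fixes c :: "nat \<Rightarrow> 'a::idom"
  shows "poly (\<Prod>k<n. [:- c k, 1:]) r = 0 \<longleftrightarrow> r \<in> c ` {..<n}"
  by (auto simp: poly_prod)

lemma poly_pencil_carrier [simp]:
  "A \<in> carrier_mat n n \<Longrightarrow> B \<in> carrier_mat n n \<Longrightarrow> poly_pencil A B \<in> carrier_mat n n"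
  by (simp add: poly_pencil_def)

lemma char_poly_pencil_eval:
  assumes A: "A \<in> carrier_mat n n" and B: "B \<in> carrier_mat n n"
  shows "char_poly (A + z \<cdot>\<^sub>m B) = map_poly (\<lambda>p. poly p z) (char_poly (poly_pencil A B))"
proof -
  have "A + z \<cdot>\<^sub>m B = map_mat (\<lambda>p. poly p z) (poly_pencil A B)"
    using A B by (auto simp: poly_pencil_def)
  then show ?thesis
    using comm_ring_hom.char_poly_hom[OF poly_hom.comm_ring_hom_axioms, of "poly_pencil A B" n z] A B
    by simp
qed

text \<open>The coefficients in X are polynomials in z that agree at every complex number, hence
  agree.\<close>

lemma char_poly_poly_pencil:
  assumes A: "A \<in> carrier_mat n n" and B: "B \<in> carrier_mat n n"
    and cp: "\<And>z. char_poly (A + z \<cdot>\<^sub>m B) = (\<Prod>k<n. [:- (a k + b k * z), 1:])"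
  shows "char_poly (poly_pencil A B) = (\<Prod>k<n. [:- [:a k, b k:], 1:])"
proof (rule poly_eqI)
  fix l
  have "map_poly (\<lambda>p. poly p z) (char_poly (poly_pencil A B)) =
      map_poly (\<lambda>p. poly p z) (\<Prod>k<n. [:- [:a k, b k:], 1:])" for z
    unfolding char_poly_pencil_eval[OF A B, symmetric] cp
      comm_ring_hom.map_poly_prod_linear[OF poly_hom.comm_ring_hom_axioms]
    by (simp add: mult.commute)
  from arg_cong[OF this, of "\<lambda>p. Polynomial.coeff p l"]
  have "poly (Polynomial.coeff (char_poly (poly_pencil A B)) l) z =
      poly (Polynomial.coeff (\<Prod>k<n. [:- [:a k, b k:], 1:]) l) z" for z
    by (simp add: coeff_map_poly)
  then show "Polynomial.coeff (char_poly (poly_pencil A B)) l =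
      Polynomial.coeff (\<Prod>k<n. [:- [:a k, b k:], 1:]) l"
    by (simp add: poly_eq_poly_eq_iff[symmetric] fun_eq_iff)
qed

text \<open>The characteristic polynomial splits already over C[t], and the embeddings into the
  fraction field and its algebraic closure are injective. Hence the generic number of eigenvalues is
  the number of distinct lines.\<close>

lemma generic_num_eigenvalues_eq:
  assumes A: "A \<in> carrier_mat n n" and B: "B \<in> carrier_mat n n"
    and CP: "char_poly (poly_pencil A B) = (\<Prod>k<n. [:- [:a k, b k:], 1:])"
  shows "generic_num_eigenvalues A B = card ((\<lambda>k. (a k, b k)) ` {..<n})"
proof -
  interpret fr: comm_ring_hom "to_fract :: complex poly \<Rightarrow> complex poly fract"
    by unfold_locales auto
  interpret ac: comm_ring_hom "to_ac :: complex poly fract \<Rightarrow> complex poly fract alg_closure"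
    by unfold_locales auto
  have "generic_pencil A B = map_mat to_fract (poly_pencil A B)"
    using A B by (auto simp: generic_pencil_def poly_pencil_def simp flip: fr.hom_add)
  then have "char_poly (generic_pencil A B) = (\<Prod>k<n. [:- to_fract [:a k, b k:], 1:])"
    using fr.char_poly_hom[of "poly_pencil A B" n] A B
    unfolding CP fr.map_poly_prod_linear by simp
  then have "{r. poly (map_poly to_ac (char_poly (generic_pencil A B))) r = 0} =
      (\<lambda>k. to_ac (to_fract [:a k, b k:])) ` {..<n}"
    by (simp add: ac.map_poly_prod_linear poly_prod_linear_eq_0_iff)
  also have "\<dots> = (\<lambda>(x, y). to_ac (to_fract [:x, y:])) ` (\<lambda>k. (a k, b k)) ` {..<n}"
    by (simp add: image_image)
  also have "card \<dots> = card ((\<lambda>k. (a k, b k)) ` {..<n})"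
    by (intro card_image) (auto simp: inj_on_def)
  finally show ?thesis by (simp add: generic_num_eigenvalues_def)
qed

text \<open>Evaluation at \<open>z\<close> maps the set of distinct lines onto the spectrum of
  \<open>A + z B\<close>; it is not injective when two lines meet, so eigenvalues are lost.\<close>

lemma exceptional_point_if_lines_meet:
  assumes A: "A \<in> carrier_mat n n" and B: "B \<in> carrier_mat n n"
    and CP: "char_poly (poly_pencil A B) = (\<Prod>k<n. [:- [:a k, b k:], 1:])"
    and k: "k < n" "l < n" and ne: "(a k, b k) \<noteq> (a l, b l)"
    and meet: "a k + b k * z = a l + b l * z"
  shows "exceptional_point A B z"
proof -
  let ?L = "(\<lambda>k. (a k, b k)) ` {..<n}" and ?ev = "\<lambda>(x, y). x + y * z"
  have "char_poly (A + z \<cdot>\<^sub>m B) = (\<Prod>k<n. [:- (a k + b k * z), 1:])"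
    unfolding char_poly_pencil_eval[OF A B] CP
      comm_ring_hom.map_poly_prod_linear[OF poly_hom.comm_ring_hom_axioms]
    by (simp add: mult.commute)
  then have "{r. poly (char_poly (A + z \<cdot>\<^sub>m B)) r = 0} = ?ev ` ?L"
    by (simp only: poly_prod_linear_eq_0_iff) (simp add: image_image)
  moreover have "\<not> inj_on ?ev ?L"
    using k ne meet by (auto simp: inj_on_def)
  then have "card (?ev ` ?L) < card ?L"
    using card_image_le[of ?L ?ev] by (auto simp: inj_on_iff_eq_card le_less)
  ultimately show ?thesis
    by (simp add: exceptional_point_def regular_point_def num_eigenvalues_def
        generic_num_eigenvalues_eq[OF A B CP])
qed

subsection \<open>Rigidity of the adjugate along a line\<close>

text \<open>A line through a point of the line X = \<open>\<alpha> + \<beta> * z\<close> with the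
  same slope \<open>\<beta>\<close> coincides with it.\<close>

lemma card_lines_through:
  fixes a b :: "nat \<Rightarrow> complex"
  shows "card {k. k < n \<and> a k + b k * z = \<alpha> + \<beta> * z} =
    card {k. k < n \<and> a k = \<alpha> \<and> b k = \<beta>} +
    card {k. k < n \<and> b k \<noteq> \<beta> \<and> a k + b k * z = \<alpha> + \<beta> * z}"
proof -
  have "{k. k < n \<and> a k + b k * z = \<alpha> + \<beta> * z} =
    {k. k < n \<and> a k = \<alpha> \<and> b k = \<beta>} \<union>
    {k. k < n \<and> b k \<noteq> \<beta> \<and> a k + b k * z = \<alpha> + \<beta> * z}" by auto
  then show ?thesis by (simp add: card_Un_disjoint disjoint_iff)
qed

text \<open>A line of slope other than \<open>\<beta>\<close> meets the given line exactly once, at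
  parameter \<open>crossing k\<close>; the sum groups these lines by their crossing.\<close>

lemma sum_card_lines_through:
  fixes a b :: "nat \<Rightarrow> complex" and \<alpha> \<beta> :: complex and n :: nat
  defines "crossing \<equiv> \<lambda>k. (\<alpha> - a k) / (b k - \<beta>)"
  defines "Z \<equiv> crossing ` {k. k < n \<and> b k \<noteq> \<beta>}"
  shows "(\<Sum>z\<in>Z. card {k. k < n \<and> b k \<noteq> \<beta> \<and> a k + b k * z = \<alpha> + \<beta> * z}) =
    card {k. k < n \<and> b k \<noteq> \<beta>}"
proof -
  have crossing: "a k + b k * z = \<alpha> + \<beta> * z \<longleftrightarrow> crossing k = z" if "b k \<noteq> \<beta>" for k z
    using that by (auto simp: crossing_def field_simps)
  have "{k. k < n \<and> b k \<noteq> \<beta> \<and> a k + b k * z = \<alpha> + \<beta> * z} =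
      {k \<in> {k. k < n \<and> b k \<noteq> \<beta>}. crossing k = z}" for z
    using crossing by auto
  then show ?thesis
    using sum.group[of "{k. k < n \<and> b k \<noteq> \<beta>}" Z crossing "\<lambda>_. 1 :: nat"] by (simp add: Z_def)
qed

lemma degree_prod_linear_power:
  "Polynomial.degree (\<Prod>z\<in>Z. [:- z, 1:] ^ e z :: 'a::idom poly) = (\<Sum>z\<in>Z. e z)"
proof -
  have "Polynomial.degree (\<Prod>z\<in>Z. [:- z, 1:] ^ e z) = (\<Sum>z\<in>Z. Polynomial.degree ([:- z, 1:] ^ e z))"
    by (rule degree_prod_eq_sum_degree) simp
  then show ?thesis by (simp add: degree_power_eq)
qed

lemma dvd_degree_le_imp_smult:
  fixes q :: "'a::field poly"
  assumes "p dvd q" and "Polynomial.degree q \<le> Polynomial.degree p"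
  shows "\<exists>c. q = Polynomial.smult c p"
proof (cases "q = 0")
  case True
  then show ?thesis by (intro exI[of _ 0]) simp
next
  case False
  obtain r where r: "q = p * r" using assms(1) by (elim dvdE)
  with False have "Polynomial.degree q = Polynomial.degree p + Polynomial.degree r"
    by (auto simp: degree_mult_eq)
  with assms(2) have "Polynomial.degree r = 0" by simp
  then obtain c where "r = [:c:]" by (auto elim: degree_eq_zeroE)
  with r show ?thesis by auto
qed

text \<open>A count of zeros. The coefficient of X^l vanishes at each crossing \<open>z\<close> to
  order at least \<open>m - 1 - l + c z\<close>, while its degree is at most the sum of all
  \<open>c z\<close>. For \<open>l < m - 1\<close> there are too many zeros; for
  \<open>l = m - 1\<close> the bounds meet, which leaves a constant times \<open>H\<close>.\<close>

lemma adj_shifted_pencil_low_coeffs: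
  fixes a b :: "nat \<Rightarrow> complex" and \<alpha> \<beta> :: complex and n :: nat
  assumes A: "A \<in> carrier_mat n n" and B: "B \<in> carrier_mat n n"
    and CP: "char_poly (poly_pencil A B) = (\<Prod>k<n. [:- [:a k, b k:], 1:])"
    and diagB: "diagonalizable B" and cpB: "char_poly B = (\<Prod>k<n. [:- b k, 1:])"
    and diagZ: "\<And>z k. k < n \<Longrightarrow> b k \<noteq> \<beta> \<Longrightarrow> a k + b k * z = \<alpha> + \<beta> * z \<Longrightarrow>
      diagonalizable (A + z \<cdot>\<^sub>m B)"
    and k0: "k0 < n" "b k0 \<noteq> \<beta>"
    and det: "det (shifted_pencil [:\<alpha>, \<beta>:] A B) \<noteq> 0"
  defines "m \<equiv> card {k. k < n \<and> a k = \<alpha> \<and> b k = \<beta>}"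
  obtains C H where "C \<in> carrier_mat n n" "H \<noteq> 0"
    "\<forall>i<n. \<forall>j<n. \<forall>l<m. Polynomial.coeff (adj_mat (shifted_pencil [:\<alpha>, \<beta>:] A B) $$ (i, j)) l =
      (if l = m - 1 then Polynomial.smult (C $$ (i, j)) H else 0)"
proof -
  let ?G = "adj_mat (shifted_pencil [:\<alpha>, \<beta>:] A B)"
  define c where "c z = card {k. k < n \<and> b k \<noteq> \<beta> \<and> a k + b k * z = \<alpha> + \<beta> * z}" for z
  define Z where "Z = (\<lambda>k. (\<alpha> - a k) / (b k - \<beta>)) ` {k. k < n \<and> b k \<noteq> \<beta>}"
  define H where "H = (\<Prod>z\<in>Z. [:- z, 1:] ^ c z)"
  have finZ: "finite Z" and neZ: "Z \<noteq> {}" using k0 by (auto simp: Z_def)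
  have "H \<noteq> 0" using finZ by (simp add: H_def)
  have degH: "Polynomial.degree H = card {k. k < n \<and> b k \<noteq> \<beta>}"
    unfolding H_def degree_prod_linear_power c_def Z_def by (rule sum_card_lines_through)
  have cp: "char_poly (A + z \<cdot>\<^sub>m B) = (\<Prod>k<n. [:- (a k + b k * z), 1:])" for z
    unfolding char_poly_pencil_eval[OF A B] CP
      comm_ring_hom.map_poly_prod_linear[OF poly_hom.comm_ring_hom_axioms]
    by (simp add: mult.commute)
  have dvd: "(\<Prod>z\<in>Z. [:- z, 1:] ^ (m - 1 - l + c z)) dvd Polynomial.coeff (?G $$ (i, j)) l"
    if ij: "i < n" "j < n" and l: "l < m" for i j l
  proof (rule prod_linear_power_dvd[OF finZ])
    fix z assume "z \<in> Z"
    then obtain k where "k < n" "b k \<noteq> \<beta>" "a k + b k * z = \<alpha> + \<beta> * z"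
      by (auto simp: Z_def field_simps)
    from diagZ[OF this] have "diagonalizable (A + z \<cdot>\<^sub>m B)" .
    from adj_shifted_pencil_vanishing_order[OF A B this cp det ij]
    have "?G $$ (i, j) \<in> vanishing_order [:- z, 1:] (m + c z - 1)"
      using card_lines_through[of n a b z \<alpha> \<beta>] by (simp add: m_def c_def mult.commute)
    then have "[:- z, 1:] ^ (m + c z - 1 - l) dvd Polynomial.coeff (?G $$ (i, j)) l"
      by (auto simp: vanishing_order_def)
    moreover have "m + c z - 1 - l = m - 1 - l + c z" using l by simp
    ultimately show "[:- z, 1:] ^ (m - 1 - l + c z) dvd Polynomial.coeff (?G $$ (i, j)) l"
      by simp
  qed
  have deg: "Polynomial.degree (Polynomial.coeff (?G $$ (i, j)) l) \<le> Polynomial.degree H"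
    if "i < n" "j < n" for i j l
    using adj_shifted_pencil_coeff_degree_le[OF A B diagB cpB det that] degH
    by (simp add: coeff_degree_le_def)
  have low: "Polynomial.coeff (?G $$ (i, j)) l = 0"
    if ij: "i < n" "j < n" and l: "l < m - 1" for i j l
  proof (rule ccontr)
    assume nz: "Polynomial.coeff (?G $$ (i, j)) l \<noteq> 0"
    have "(\<Sum>z\<in>Z. m - 1 - l + c z) \<le> Polynomial.degree (Polynomial.coeff (?G $$ (i, j)) l)"
      using dvd_imp_degree_le[OF dvd[OF ij] nz] l by (simp add: degree_prod_linear_power)
    also have "\<dots> \<le> (\<Sum>z\<in>Z. c z)"
      using deg[OF ij] by (simp add: H_def degree_prod_linear_power)
    \<comment> \<open>Each crossing has an excess of \<open>m - 1 - l\<close> zeros;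
      \<open>k0\<close> provides at least one crossing.\<close>
    finally have "card Z * (m - 1 - l) = 0" by (simp add: sum.distrib)
    then show False using finZ neZ l by simp
  qed
  \<comment> \<open>The guard \<open>0 < m\<close> keeps \<open>m - 1\<close> from being
    truncated.\<close>
  have "\<forall>i j. \<exists>x. i < n \<longrightarrow> j < n \<longrightarrow> 0 < m \<longrightarrow>
      Polynomial.coeff (?G $$ (i, j)) (m - 1) = Polynomial.smult x H"
    using dvd_degree_le_imp_smult[OF _ deg] dvd[of _ _ "m - 1"] by (simp flip: H_def)
  then obtain C where C: "\<And>i j. i < n \<Longrightarrow> j < n \<Longrightarrow> 0 < m \<Longrightarrow>
      Polynomial.coeff (?G $$ (i, j)) (m - 1) = Polynomial.smult (C i j) H"
    by metis
  show thesis
  proof (rule that[of "mat n n (\<lambda>(i, j). C i j)" H])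
    show "\<forall>i<n. \<forall>j<n. \<forall>l<m. Polynomial.coeff (?G $$ (i, j)) l =
      (if l = m - 1 then Polynomial.smult (mat n n (\<lambda>(i, j). C i j) $$ (i, j)) H else 0)"
      using C low by (auto simp: less_diff_conv)
  qed (use \<open>H \<noteq> 0\<close> in auto)
qed

lemma mult_mat_entry:
  assumes "M \<in> carrier_mat n n" "M' \<in> carrier_mat n n" "i < n" "j < n"
  shows "(M * M') $$ (i, j) = (\<Sum>r<n. M $$ (i, r) * M' $$ (r, j))"
  using assms by (simp add: scalar_prod_def atLeast0LessThan)

text \<open>Since X^m divides \<open>det N\<close>, the coefficient of X^(m-1) in
  \<open>N * adj_mat N\<close> is 0, which makes the columns of \<open>C\<close> common eigenvectors
  of \<open>A\<close> and \<open>B\<close>. The commutator kills them, and below X^m the adjugate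
  contains nothing but \<open>C\<close>.\<close>

lemma commutator_adj_shifted_pencil_dvd:
  assumes A: "A \<in> carrier_mat n n" and B: "B \<in> carrier_mat n n"
    and CP: "char_poly (poly_pencil A B) = (\<Prod>k<n. [:- [:a k, b k:], 1:])"
    and diagB: "diagonalizable B" and cpB: "char_poly B = (\<Prod>k<n. [:- b k, 1:])"
    and diagZ: "\<And>z k. k < n \<Longrightarrow> b k \<noteq> \<beta> \<Longrightarrow> a k + b k * z = \<alpha> + \<beta> * z \<Longrightarrow>
      diagonalizable (A + z \<cdot>\<^sub>m B)"
    and k0: "k0 < n" "b k0 \<noteq> \<beta>"
    and ij: "i < n" "j < n"
  shows "Polynomial.monom 1 (card {k. k < n \<and> a k = \<alpha> \<and> b k = \<beta>}) dvd
    (const_mat (A * B - B * A) * adj_mat (shifted_pencil [:\<alpha>, \<beta>:] A B)) $$ (i, j)"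
proof -
  define N where "N = shifted_pencil [:\<alpha>, \<beta>:] A B"
  define m where "m = card {k. k < n \<and> a k = \<alpha> \<and> b k = \<beta>}"
  have N: "N \<in> carrier_mat n n" using A B by (simp add: N_def)
  note G = adj_mat[OF N]
  have "det N = (\<Prod>k<n. [:- [:a k, b k:], 1:] \<circ>\<^sub>p [:[:\<alpha>, \<beta>:], 1:])"
    unfolding N_def det_shifted_pencil[OF A B] CP by (rule pcompose_prod)
  also have "\<dots> = (\<Prod>k<n. [:- ([:a k, b k:] - [:\<alpha>, \<beta>:]), 1:])"
    by (intro prod.cong) (auto simp: pcompose_pCons)
  finally have detN: "det N = (\<Prod>k<n. [:- ([:a k, b k:] - [:\<alpha>, \<beta>:]), 1:])" .
  then have det0: "det N \<noteq> 0" by (simp add: prod_zero_iff)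
  have "Polynomial.order 0 (det N) = m"
    unfolding detN order_prod_linear by (simp add: m_def)
  then have "Polynomial.monom 1 m dvd det N"
    using det0 by (simp add: monom_1_dvd_iff)
  then have det_low: "Polynomial.coeff (det N) l = 0" if "l < m" for l
    using that by (auto simp: monom_1_dvd_iff')
  obtain C H where C: "C \<in> carrier_mat n n" and H: "H \<noteq> 0"
    and CH: "\<forall>i<n. \<forall>j<n. \<forall>l<m. Polynomial.coeff (adj_mat N $$ (i, j)) l =
      (if l = m - 1 then Polynomial.smult (C $$ (i, j)) H else 0)"
    unfolding N_def m_def
    by (rule adj_shifted_pencil_low_coeffs[OF A B CP diagB cpB diagZ k0 det0[unfolded N_def]])
  have WC: "((A * B - B * A) * C) $$ (i, j) = 0" if "0 < m" "i < n" "j < n" for i j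
  proof -
    have eig: "(\<Sum>r<n. A $$ (i, r) * C $$ (r, j)) = \<alpha> * C $$ (i, j) \<and>
        (\<Sum>r<n. B $$ (i, r) * C $$ (r, j)) = \<beta> * C $$ (i, j)" if ij: "i < n" "j < n" for i j
    proof -
      define u where "u r = (if i = r then [:\<alpha>, \<beta>:] else 0) - [:A $$ (i, r), B $$ (i, r):]" for r
      \<comment> \<open>The X-term of \<open>N\<close> would contribute the coefficient of X^(m-2)
        in the adjugate, which is 0 or absent; only the term \<open>u r\<close>, free of X,
        remains.\<close>
      have "Polynomial.coeff (N $$ (i, r) * adj_mat N $$ (r, j)) (m - 1) =
          H * Polynomial.smult (C $$ (r, j)) (u r)" if r: "r < n" for r
      proof -
        have "N $$ (i, r) = [:u r, if i = r then 1 else 0:]"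
          unfolding N_def u_def by (rule shifted_pencil_index[OF A B ij(1) r])
        then show ?thesis
          using CH r ij(2) \<open>0 < m\<close>
          by (cases "m - 1") (auto simp: coeff_pCons mult.commute)
      qed
      then have "Polynomial.coeff ((N * adj_mat N) $$ (i, j)) (m - 1) =
          H * (\<Sum>r<n. Polynomial.smult (C $$ (r, j)) (u r))"
        by (simp add: mult_mat_entry[OF N G(1) ij] coeff_sum sum_distrib_left)
      moreover have "Polynomial.coeff ((N * adj_mat N) $$ (i, j)) (m - 1) = 0"
        using ij det_low \<open>0 < m\<close> by (simp add: G(2))
      ultimately have "(\<Sum>r<n. Polynomial.smult (C $$ (r, j)) (u r)) = 0"
        using H by simp
      then have "Polynomial.coeff (\<Sum>r<n. Polynomial.smult (C $$ (r, j)) (u r)) l = 0" for l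
        by simp
      \<comment> \<open>Neither \<open>C\<close> nor the matrices involve z, so the coefficients of
        z^0 and z^1 yield the eigenvector equations for \<open>A\<close> and for \<open>B\<close>
        separately.\<close>
      from this[of 0] this[of 1] show ?thesis
        using ij by (simp add: coeff_sum u_def if_distrib[of "\<lambda>p. Polynomial.coeff p _"]
            right_diff_distrib sum_subtractf sum.delta' if_distrib[of "\<lambda>x. _ * x"]
            mult.commute cong: if_cong)
    qed
    have AC: "A * C = \<alpha> \<cdot>\<^sub>m C"
      using eig A C by (intro eq_matI) (auto simp: mult_mat_entry[of _ n] simp del: index_mult_mat(1))
    have BC: "B * C = \<beta> \<cdot>\<^sub>m C"
      using eig B C by (intro eq_matI) (auto simp: mult_mat_entry[of _ n] simp del: index_mult_mat(1))
    have "(A * B - B * A) * C = A * (B * C) - B * (A * C)"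
      using A B C by (simp add: minus_mult_distrib_mat[of _ n n _ _ n])
    also have "\<dots> = \<beta> \<cdot>\<^sub>m (\<alpha> \<cdot>\<^sub>m C) - \<alpha> \<cdot>\<^sub>m (\<beta> \<cdot>\<^sub>m C)"
      using A B C by (simp add: AC BC mult_smult_distrib[of _ n n _ n])
    finally show ?thesis using that C by simp
  qed
  define W where "W = A * B - B * A"
  have W: "W \<in> carrier_mat n n" using A B by (simp add: W_def minus_carrier_mat)
  have "Polynomial.coeff ((const_mat W * adj_mat N) $$ (i, j)) l = 0" if l: "l < m" for l
  proof -
    have "Polynomial.coeff ((const_mat W * adj_mat N) $$ (i, j)) l =
        (\<Sum>r<n. Polynomial.smult (W $$ (i, r)) (Polynomial.coeff (adj_mat N $$ (r, j)) l))"
      using W by (simp add: mult_mat_entry[OF _ G(1) ij] coeff_sum const_mat_index[OF W ij(1)])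
    also have "\<dots> = (if l = m - 1 then Polynomial.smult ((W * C) $$ (i, j)) H else 0)"
      using CH l ij by (simp add: mult_mat_entry[OF W C ij] smult_sum)
    also have "\<dots> = 0" using WC[of i j] ij l by (simp add: W_def)
    finally show ?thesis .
  qed
  then show ?thesis
    unfolding monom_1_dvd_iff' N_def m_def W_def by simp
qed

subsection \<open>Commutativity\<close>

lemma graded_family_degree_le:
  "graded_family (\<lambda>d. {q :: 'a::comm_ring_1 poly. Polynomial.degree q \<le> d})"
  by unfold_locales (auto intro: degree_add_le order.trans[OF degree_mult_le] add_mono)

text \<open>A nonzero \<open>q\<close> would have at least \<open>n\<close> roots counted with
  order. Counting roots works over any domain, in particular over C[z], where X - f and X - g need
  not generate the unit ideal.\<close>

lemma eq_0_if_prod_linear_power_dvd: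
  fixes q :: "'a::idom poly" and c :: "nat \<Rightarrow> 'a"
  assumes dvd: "\<And>k. k < n \<Longrightarrow> [:- c k, 1:] ^ card {l. l < n \<and> c l = c k} dvd q"
    and deg: "Polynomial.degree q < n"
  shows "q = 0"
proof (rule ccontr)
  assume q: "q \<noteq> 0"
  have le: "card {l. l < n \<and> c l = c k} \<le> Polynomial.order (c k) q" if "k < n" for k
    using dvd[OF that] q by (simp add: order_divides)
  have pos: "card {l. l < n \<and> c l = c k} > 0" if "k < n" for k
    using that by (auto simp: card_gt_0_iff)
  have "n = (\<Sum>x\<in>c ` {..<n}. card {l. l < n \<and> c l = x})"
    using sum.group[of "{..<n}" "c ` {..<n}" c "\<lambda>_. 1 :: nat"] by simp
  also have "\<dots> \<le> (\<Sum>x\<in>c ` {..<n}. Polynomial.order x q)"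
    using le by (intro sum_mono) auto
  also have "\<dots> \<le> (\<Sum>x | poly q x = 0. Polynomial.order x q)"
  proof (rule sum_mono2[OF poly_roots_finite[OF q]])
    show "c ` {..<n} \<subseteq> {x. poly q x = 0}"
      using le pos q by (force simp: order_root)
  qed auto
  also have "\<dots> \<le> Polynomial.degree q" by (rule sum_order_le_degree[OF q])
  finally show False using deg by simp
qed

text \<open>Settles the case in which all lines are parallel and there are no crossings to count
  zeros at.\<close>

lemma diagonalizable_single_eigenvalue:
  assumes diag: "diagonalizable B" and B: "B \<in> carrier_mat n n"
    and cp: "char_poly B = (\<Prod>k<n. [:- b k, 1:])" and b: "\<And>k. k < n \<Longrightarrow> b k = \<beta>"
  shows "B = \<beta> \<cdot>\<^sub>m 1\<^sub>m n"
proof -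
  obtain S T D where S: "S \<in> carrier_mat n n" and T: "T \<in> carrier_mat n n"
    and D: "D \<in> carrier_mat n n" and ST: "S * T = 1\<^sub>m n" "T * S = 1\<^sub>m n"
    and TBS: "D = T * B * S" and dD: "diagonal_mat D"
    and count: "\<forall>x. card {i. i < n \<and> D $$ (i, i) = x} = card {k. k < n \<and> b k = x}"
    by (rule diagonalizableE[OF diag B cp])
  have "{k. k < n \<and> b k = \<beta>} = {..<n}" using b by auto
  then have "card {i. i < n \<and> D $$ (i, i) = \<beta>} = card {..<n}" using count by simp
  then have "{i. i < n \<and> D $$ (i, i) = \<beta>} = {..<n}"
    by (intro card_subset_eq) auto
  then have "D = \<beta> \<cdot>\<^sub>m 1\<^sub>m n"
    using dD D by (intro eq_matI) (auto simp: diagonal_mat_def)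
  moreover have "B = S * D * T"
    unfolding TBS by (rule conjugate_inverse[OF B S T ST(1), symmetric])
  ultimately show ?thesis
    using S T ST by (simp add: mult_smult_distrib[of _ n n _ n] mult_smult_assoc_mat[of _ n n _ n])
qed

theorem mainTheorem6:
  fixes A B :: "complex mat" and n :: nat
  assumes "A \<in> carrier_mat n n" and "B \<in> carrier_mat n n"
    and "property_L n A B"
    and "diagonalizable B"
    and "\<And>z0. exceptional_point A B z0 \<Longrightarrow> diagonalizable (A + z0 \<cdot>\<^sub>m B)"
  shows "A * B = B * A"
proof -
  note A = assms(1) and B = assms(2)
  obtain a b where L: "\<And>x y. char_poly (x \<cdot>\<^sub>m A + y \<cdot>\<^sub>m B) = (\<Prod>k<n. [:- (a k * x + b k * y), 1:])"
    using assms(3) unfolding property_L_def by blast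
  have "1 \<cdot>\<^sub>m A = A" using A by auto
  then have "char_poly (A + z \<cdot>\<^sub>m B) = (\<Prod>k<n. [:- (a k + b k * z), 1:])" for z
    using L[of 1 z] by simp
  then have CP: "char_poly (poly_pencil A B) = (\<Prod>k<n. [:- [:a k, b k:], 1:])"
    by (rule char_poly_poly_pencil[OF A B])
  \<comment> \<open>Property L in the direction (0, 1) shows that the slopes \<open>b k\<close> are
    the eigenvalues of \<open>B\<close>.\<close>
  have "0 \<cdot>\<^sub>m A + 1 \<cdot>\<^sub>m B = B" using A B by auto
  then have cpB: "char_poly B = (\<Prod>k<n. [:- b k, 1:])"
    using L[of 0 1] by simp
  show ?thesis
  \<comment> \<open>If the slopes are not all equal, every line is crossed by another one, as the
    zero count requires; \<open>n = 0\<close> falls under the first case.\<close>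
  proof (cases "\<exists>\<beta>. \<forall>k<n. b k = \<beta>")
    case True
    then obtain \<beta> where "B = \<beta> \<cdot>\<^sub>m 1\<^sub>m n"
      using diagonalizable_single_eigenvalue[OF assms(4) B cpB] by blast
    then show ?thesis
      using A by (simp add: mult_smult_distrib[of _ n n _ n] mult_smult_assoc_mat[of _ n n _ n])
  next
    case False
    define N where "N = char_poly_matrix (poly_pencil A B)"
    define W where "W = A * B - B * A"
    have N: "N \<in> carrier_mat n n" using A B by (simp add: N_def)
    note G = adj_mat[OF N]
    have W: "W \<in> carrier_mat n n" using A B by (simp add: W_def minus_carrier_mat)
    have WG: "(const_mat W * adj_mat N) $$ (i, j) = 0" if ij: "i < n" "j < n" for i j
    proof (rule eq_0_if_prod_linear_power_dvd)
      let ?q = "(const_mat W * adj_mat N) $$ (i, j)"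
      fix k assume k: "k < n"
      define f where "f = [:a k, b k:]"
      have cW: "map_mat (\<lambda>q. q \<circ>\<^sub>p [:f, 1:]) (const_mat W) = const_mat W"
        by (auto simp: const_mat_def)
      obtain k0 where k0: "k0 < n" "b k0 \<noteq> b k" using False by blast
      have diagZ: "diagonalizable (A + z \<cdot>\<^sub>m B)"
        if "l < n" "b l \<noteq> b k" "a l + b l * z = a k + b k * z" for l z
        using exceptional_point_if_lines_meet[OF A B CP that(1) k _ that(3)] that(2) assms(5) by auto
      have "Polynomial.monom 1 (card {l. l < n \<and> a l = a k \<and> b l = b k}) dvd
          (const_mat W * adj_mat (shifted_pencil f A B)) $$ (i, j)"
        unfolding W_def f_def
        by (rule commutator_adj_shifted_pencil_dvd[OF A B CP assms(4) cpB diagZ k0 ij])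
      also have "adj_mat (shifted_pencil f A B) = map_mat (\<lambda>q. q \<circ>\<^sub>p [:f, 1:]) (adj_mat N)"
        unfolding shifted_pencil_char_poly_matrix[OF A B] N_def[symmetric]
        by (rule comm_ring_hom.adj_mat_hom[OF pcompose_hom.comm_ring_hom_axioms N])
      also have "const_mat W * map_mat (\<lambda>q. q \<circ>\<^sub>p [:f, 1:]) (adj_mat N) =
          map_mat (\<lambda>q. q \<circ>\<^sub>p [:f, 1:]) (const_mat W * adj_mat N)"
        using semiring_hom.mat_hom_mult[OF pcompose_hom.semiring_hom_axioms, of "const_mat W" n n
            "adj_mat N" n "[:f, 1:]"] W G(1)
        by (simp add: cW)
      also have "\<dots> $$ (i, j) = ?q \<circ>\<^sub>p [:f, 1:]"
        using ij W G(1) by simp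
      finally obtain r where
        "?q \<circ>\<^sub>p [:f, 1:] = [:0, 1:] ^ card {l. l < n \<and> a l = a k \<and> b l = b k} * r"
        by (auto simp: monom_altdef elim: dvdE)
      \<comment> \<open>The substitution X -> X - f undoes the shift and turns the power of X into a
        power of X - f.\<close>
      then have "?q \<circ>\<^sub>p [:f, 1:] \<circ>\<^sub>p [:- f, 1:] =
          [:- f, 1:] ^ card {l. l < n \<and> a l = a k \<and> b l = b k} * r \<circ>\<^sub>p [:- f, 1:]"
        by (simp add: pcompose_mult pcompose_hom.hom_power pcompose_pCons)
      moreover have "?q \<circ>\<^sub>p [:f, 1:] \<circ>\<^sub>p [:- f, 1:] = ?q"
        by (simp add: pcompose_assoc[symmetric] pcompose_pCons)
      ultimately have "?q = [:- f, 1:] ^ card {l. l < n \<and> a l = a k \<and> b l = b k} * r \<circ>\<^sub>p [:- f, 1:]"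
        by (simp only:)
      then have "[:- f, 1:] ^ card {l. l < n \<and> a l = a k \<and> b l = b k} dvd ?q"
        by (rule dvdI)
      then show "[:- [:a k, b k:], 1:] ^ card {l. l < n \<and> [:a l, b l:] = [:a k, b k:]} dvd ?q"
        by (simp add: f_def)
    next
      interpret graded_family "\<lambda>d. {q :: complex poly poly. Polynomial.degree q \<le> d}"
        by (rule graded_family_degree_le)
      have "Polynomial.degree (N $$ (r, c)) \<le> 1" if "r < n" "c < n" for r c
        using that A B by (auto simp: N_def char_poly_matrix_def poly_pencil_def)
      \<comment> \<open>Every row has weight 1 for the degree in X, and a cofactor uses
        \<open>n - 1\<close> rows.\<close>
      then have "Polynomial.degree (adj_mat N $$ (r, c)) \<le> n - 1" if "r < n" "c < n" for r c
        using adj_mat_mem[OF N _ that, of "\<lambda>_. 1"] that by (simp add: card_Diff_subset)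
      then have "Polynomial.degree ((const_mat W * adj_mat N) $$ (i, j)) \<le> 0 + (n - 1)"
        using mat_mult_mem[of "const_mat W" n "adj_mat N" 0 "n - 1" i j] W G(1) ij
        by (simp add: const_mat_index[OF W])
      then show "Polynomial.degree ((const_mat W * adj_mat N) $$ (i, j)) < n"
        using ij by linarith
    qed
    have "det N \<noteq> 0"
      unfolding N_def char_poly_def[symmetric] CP by (simp add: prod_zero_iff)
    have "const_mat W * adj_mat N = 0\<^sub>m n n"
      using W G(1) WG by (intro eq_matI) auto
    \<comment> \<open>Multiplication by \<open>N\<close> on the right turns the adjugate into the
      nonzero scalar \<open>det N\<close>, which can be cancelled.\<close>
    then have "(const_mat W * adj_mat N) * N = 0\<^sub>m n n"
      using N by simp
    then have "det N \<cdot>\<^sub>m const_mat W = 0\<^sub>m n n"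
      using W N G by (simp add: assoc_mult_mat[of _ n n _ n _ n] mult_smult_distrib[of _ n n _ n])
    have W0: "W $$ (i, j) = 0" if "i < n" "j < n" for i j
    proof -
      have "(det N \<cdot>\<^sub>m const_mat W) $$ (i, j) = det N * [:[:W $$ (i, j):]:]"
        using that W by (simp add: const_mat_def)
      then show ?thesis
        using \<open>det N \<cdot>\<^sub>m const_mat W = 0\<^sub>m n n\<close> \<open>det N \<noteq> 0\<close> that by simp
    qed
    show ?thesis
    proof (rule eq_matI)
      fix i j assume "i < dim_row (B * A)" "j < dim_col (B * A)"
      then show "(A * B) $$ (i, j) = (B * A) $$ (i, j)"
        using W0[of i j] A B by (simp add: W_def)
    qed (use A B in auto)
  qed
qed

end
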